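(* Let $0<r<1$, let $\varphi(z)=rz+1-r$ for $z$ in the open unit disk $\mathbb{D}$ (a hyperbolic nonautomorphism of the first kind), and let $C_\varphi f=f\circ\varphi$ be the composition operator on the Bergman space $L^2_a$. Then the set of extended eigenvalues of $C_\varphi$ is the punctured closed unit disk: $$\mathrm{Ext}(C_\varphi)=\overline{\mathbb{D}}\setminus\{0\}=\{\lambda\in\mathbb{C}:0<|\lambda|\le 1\}.$$
   Context: The Bergman space $L^2_a$ is the Hilbert space of holomorphic functions $f$ on the open unit disk $\mathbb{D}$ with $\|f\|^2=\frac{1}{\pi}\int_{\mathbb{D}}|f(z)|^2\,dA(z)<\infty$, where $dA$ is Lebesgue area measure. For a bounded linear operator $A$ on a complex Hilbert space $H$, a scalar $\lambda\in\mathbb{C}$ is an extended eigenvalue of $A$ if there is a nonzero bounded linear operator $X$ on $H$ with $AX=\lambda XA$; $\mathrm{Ext}(A)$ denotes the set of all extended eigenvalues of $A$. *)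

theory Defs
  imports "HOL-Complex_Analysis.Complex_Analysis"
begin

text \<open>
  Complex Hilbert spaces of functions are represented by a carrier set \<open>H\<close> of functions into
  \<open>complex\<close> with the pointwise vector space operations, together with a norm \<open>N\<close> on \<open>H\<close>.
  Operators are considered on \<open>H\<close> only: their values outside \<open>H\<close> are irrelevant.
\<close>

definition bounded_operator_on ::
  "('a \<Rightarrow> complex) set \<Rightarrow> (('a \<Rightarrow> complex) \<Rightarrow> real) \<Rightarrow> (('a \<Rightarrow> complex) \<Rightarrow> ('a \<Rightarrow> complex)) \<Rightarrow> bool"
where
  "bounded_operator_on H N X \<longleftrightarrow>
     (\<forall>f\<in>H. X f \<in> H) \<and>
     (\<forall>f\<in>H. \<forall>g\<in>H. X (\<lambda>z. f z + g z) = (\<lambda>z. X f z + X g z)) \<and>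
     (\<forall>c. \<forall>f\<in>H. X (\<lambda>z. c * f z) = (\<lambda>z. c * X f z)) \<and>
     (\<exists>K. \<forall>f\<in>H. N (X f) \<le> K * N f)"

definition extended_eigenvalues ::
  "('a \<Rightarrow> complex) set \<Rightarrow> (('a \<Rightarrow> complex) \<Rightarrow> real) \<Rightarrow> (('a \<Rightarrow> complex) \<Rightarrow> ('a \<Rightarrow> complex)) \<Rightarrow> complex set"
where
  "extended_eigenvalues H N A =
     {\<mu>. \<exists>X. bounded_operator_on H N X \<and> (\<exists>f\<in>H. X f \<noteq> (\<lambda>z. 0)) \<and>
            (\<forall>f\<in>H. A (X f) = (\<lambda>z. \<mu> * X (A f) z))}"

text \<open>
  A function on the open unit disk is represented by its extension by \<open>0\<close> to the whole plane, so
  that equality of elements of the space is equality of HOL functions. The measure \<open>lborel\<close>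
  on \<open>complex\<close> is area measure.
\<close>

definition bergman_space :: "(complex \<Rightarrow> complex) set" where
  "bergman_space =
     {f. f holomorphic_on ball 0 1 \<and> (\<forall>z. z \<notin> ball 0 1 \<longrightarrow> f z = 0) \<and>
         set_integrable lborel (ball 0 1) (\<lambda>z. (cmod (f z))\<^sup>2)}"

definition bergman_norm :: "(complex \<Rightarrow> complex) \<Rightarrow> real" where
  "bergman_norm f = sqrt (1 / pi * (LINT z:ball 0 1|lborel. (cmod (f z))\<^sup>2))"

definition composition_operator ::
  "(complex \<Rightarrow> complex) \<Rightarrow> (complex \<Rightarrow> complex) \<Rightarrow> complex \<Rightarrow> complex" where
  "composition_operator \<phi> f = (\<lambda>z. if z \<in> ball 0 1 then f (\<phi> z) else 0)"

end

theory Submission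
  imports Defs
begin

text \<open>
  The map \<open>\<phi>\<close> fixes 1 and is multiplication by \<open>r\<close> in the coordinate \<open>w = 1 - z\<close>. Hence the functions
  $w^s$ satisfy $C_\<phi> w^s = r^s w^s$, and they lie in the Bergman space when \<open>Re s > -1\<close>.

  Every \<open>\<mu>\<close> with \<open>0 < cmod \<mu> \<le> 1\<close> is an extended eigenvalue: write $\<mu> = r^s$ with \<open>Re s \<ge> 0\<close>. Then $w^s$
  is a bounded function, and multiplication by it intertwines as required
  (\<open>punctured_disk_subset_extended_eigenvalues\<close>).

  Conversely, let $C_\<phi> X = \<mu> X C_\<phi>$ with \<open>X \<noteq> 0\<close>. By the identity theorem $C_\<phi>$ is injective, so
  \<open>\<mu> \<noteq> 0\<close>. Suppose \<open>cmod \<mu> > 1\<close>. Then $X w^s$ satisfies $C_\<phi> X w^s = \<mu> r^s X w^s$. A change of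
  variables shows that all eigenvalues of $C_\<phi>$ have modulus less than $1/r$
  (\<open>composition_eigenvalue_bound\<close>). The factor \<open>cmod \<mu>\<close> pushes $\<mu> r^s$ out of that range for all
  \<open>s\<close> in a strip \<open>-1 < Re s < -1 + \<delta>\<close>, so $X w^s = 0$ there. These powers are total
  (\<open>functional_zero_if_cpower_zero\<close>), because $s \<mapsto> w^s$ is holomorphic on the half plane
  \<open>Re s > -1\<close> with values in the Bergman space, the strip determines the values at the nonnegative
  integers, and polynomials are dense. Hence \<open>X = 0\<close>, a contradiction.
\<close>

section \<open>The Bergman space inside square-integrable functions\<close>

definition on_disk :: "(complex \<Rightarrow> complex) \<Rightarrow> complex \<Rightarrow> complex" where
  "on_disk f = (\<lambda>z. if z \<in> ball 0 1 then f z else 0)"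

text \<open>
  Elements of the Bergman space vanish off the disk, so the integral over the disk in the
  Bergman norm is an integral over the whole plane; the factor $1/\<pi>$ is dropped as well.
\<close>
definition sqnorm :: "(complex \<Rightarrow> complex) \<Rightarrow> real" where
  "sqnorm f = (\<integral>z. (cmod (f z))\<^sup>2 \<partial>lborel)"

lemma on_disk_apply [simp]: "z \<in> ball 0 1 \<Longrightarrow> on_disk f z = f z"
  by (simp add: on_disk_def)

lemma on_disk_outside [simp]: "z \<notin> ball 0 1 \<Longrightarrow> on_disk f z = 0"
  by (simp add: on_disk_def)

lemma on_disk_holomorphic: "f holomorphic_on ball 0 1 \<Longrightarrow> on_disk f holomorphic_on ball 0 1"
  by (rule holomorphic_transform) auto

lemma indicator_disk_absorb:
  assumes "\<And>z. z \<notin> ball 0 1 \<Longrightarrow> f z = (0::complex)"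
  shows "(\<lambda>z. indicat_real (ball 0 1) z *\<^sub>R (cmod (f z))\<^sup>2) = (\<lambda>z. (cmod (f z))\<^sup>2)"
  using assms by (auto simp: fun_eq_iff indicator_def)

lemma bergman_space_iff:
  "f \<in> bergman_space \<longleftrightarrow> f holomorphic_on ball 0 1 \<and> (\<forall>z. z \<notin> ball 0 1 \<longrightarrow> f z = 0) \<and>
     integrable lborel (\<lambda>z. (cmod (f z))\<^sup>2)"
proof (cases "\<forall>z. z \<notin> ball 0 1 \<longrightarrow> f z = 0")
  case True
  have "(\<lambda>z. indicat_real (ball 0 1) z *\<^sub>R (cmod (f z))\<^sup>2) = (\<lambda>z. (cmod (f z))\<^sup>2)"
    by (rule indicator_disk_absorb) (use True in blast)
  with True show ?thesis
    by (simp add: bergman_space_def set_integrable_def)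
qed (auto simp: bergman_space_def)

lemma
  assumes "f \<in> bergman_space"
  shows bergman_holomorphic: "f holomorphic_on ball 0 1"
    and bergman_outside: "z \<notin> ball 0 1 \<Longrightarrow> f z = 0"
    and bergman_integrable: "integrable lborel (\<lambda>z. (cmod (f z))\<^sup>2)"
  using assms by (auto simp: bergman_space_iff)

lemma bergman_norm_eq:
  assumes "f \<in> bergman_space"
  shows "bergman_norm f = sqrt (sqnorm f / pi)"
proof -
  have "(\<lambda>z. indicat_real (ball 0 1) z *\<^sub>R (cmod (f z))\<^sup>2) = (\<lambda>z. (cmod (f z))\<^sup>2)"
    by (rule indicator_disk_absorb) (use bergman_outside[OF assms] in blast)
  then show ?thesis
    by (simp add: bergman_norm_def sqnorm_def set_lebesgue_integral_def)
qed

lemma sqnorm_nonneg [simp]: "0 \<le> sqnorm f"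
  by (simp add: sqnorm_def)

lemma borel_measurable_on_disk:
  assumes "f holomorphic_on ball 0 1" and "\<And>z. z \<notin> ball 0 1 \<Longrightarrow> f z = 0"
  shows "f \<in> borel_measurable borel"
proof -
  have "(\<lambda>z. indicat_real (ball 0 1) z *\<^sub>R f z) \<in> borel_measurable borel"
    using assms(1)
    by (intro borel_measurable_continuous_on_indicator) (auto intro: holomorphic_on_imp_continuous_on)
  also have "(\<lambda>z. indicat_real (ball 0 1) z *\<^sub>R f z) = f"
    using assms(2) by (auto simp: fun_eq_iff indicator_def)
  finally show ?thesis .
qed

lemma bergman_measurable: "f \<in> bergman_space \<Longrightarrow> f \<in> borel_measurable borel"
  by (rule borel_measurable_on_disk) (auto simp: bergman_space_iff)

lemma bergman_dominated:
  assumes "f holomorphic_on ball 0 1" and "\<And>z. z \<notin> ball 0 1 \<Longrightarrow> f z = 0"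
    and "integrable lborel g" and "\<And>z. (cmod (f z))\<^sup>2 \<le> g z"
  shows "f \<in> bergman_space" and "sqnorm f \<le> (\<integral>z. g z \<partial>lborel)"
proof -
  have [measurable]: "f \<in> borel_measurable borel"
    by (rule borel_measurable_on_disk) (use assms in auto)
  have "integrable lborel (\<lambda>z. (cmod (f z))\<^sup>2)"
  proof (rule Bochner_Integration.integrable_bound[OF assms(3)])
    show "AE z in lborel. norm ((cmod (f z))\<^sup>2) \<le> norm (g z)"
      using assms(4) by (auto intro: order_trans[OF _ abs_ge_self])
  qed auto
  then show "f \<in> bergman_space" and "sqnorm f \<le> (\<integral>z. g z \<partial>lborel)"
    using assms by (auto simp: bergman_space_iff sqnorm_def intro!: integral_mono)
qed

lemma cmod_add_sq_le: "(cmod (a + b))\<^sup>2 \<le> 2 * (cmod a)\<^sup>2 + 2 * (cmod b)\<^sup>2"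
proof -
  have "(cmod (a + b))\<^sup>2 \<le> (cmod a + cmod b)\<^sup>2"
    by (intro power_mono norm_triangle_ineq) auto
  also have "\<dots> \<le> 2 * (cmod a)\<^sup>2 + 2 * (cmod b)\<^sup>2"
    using sum_squares_bound[of "cmod a" "cmod b"] by (simp add: power2_sum)
  finally show ?thesis .
qed

lemma bergman_add:
  assumes "f \<in> bergman_space" "g \<in> bergman_space"
  shows "(\<lambda>z. f z + g z) \<in> bergman_space"
proof (rule bergman_dominated(1)[where g = "\<lambda>z. 2 * (cmod (f z))\<^sup>2 + 2 * (cmod (g z))\<^sup>2"])
  show "integrable lborel (\<lambda>z. 2 * (cmod (f z))\<^sup>2 + 2 * (cmod (g z))\<^sup>2)"
    using assms by (auto simp: bergman_integrable)
qed (use assms in \<open>auto simp: bergman_outside cmod_add_sq_le intro!: holomorphic_on_add bergman_holomorphic[OF assms(1)] bergman_holomorphic[OF assms(2)]\<close>)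

lemma bergman_scale:
  assumes "f \<in> bergman_space"
  shows "(\<lambda>z. c * f z) \<in> bergman_space"
proof (rule bergman_dominated(1)[where g = "\<lambda>z. (cmod c)\<^sup>2 * (cmod (f z))\<^sup>2"])
  show "integrable lborel (\<lambda>z. (cmod c)\<^sup>2 * (cmod (f z))\<^sup>2)"
    using assms by (auto simp: bergman_integrable)
qed (use assms in \<open>auto simp: bergman_outside norm_mult power_mult_distrib intro!: holomorphic_on_mult bergman_holomorphic[OF assms]\<close>)

lemma bergman_diff:
  assumes "f \<in> bergman_space" "g \<in> bergman_space"
  shows "(\<lambda>z. f z - g z) \<in> bergman_space"
  using bergman_add[OF assms(1) bergman_scale[OF assms(2), of "-1"]] by simp

lemma bergman_bounded_mult:
  assumes f: "f \<in> bergman_space" and g: "g holomorphic_on ball 0 1"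
    and B: "\<And>z. z \<in> ball 0 1 \<Longrightarrow> cmod (g z) \<le> B"
  shows "on_disk (\<lambda>z. g z * f z) \<in> bergman_space"
    and "sqnorm (on_disk (\<lambda>z. g z * f z)) \<le> B\<^sup>2 * sqnorm f"
proof -
  have hol: "on_disk (\<lambda>z. g z * f z) holomorphic_on ball 0 1"
    by (intro on_disk_holomorphic holomorphic_intros g bergman_holomorphic f)
  have int: "integrable lborel (\<lambda>z. B\<^sup>2 * (cmod (f z))\<^sup>2)"
    using bergman_integrable[OF f] by auto
  have bd: "(cmod (on_disk (\<lambda>z. g z * f z) z))\<^sup>2 \<le> B\<^sup>2 * (cmod (f z))\<^sup>2" for z
    using B[of z]
    by (auto simp: on_disk_def norm_mult power_mult_distrib intro!: mult_right_mono power_mono)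
  note * = bergman_dominated[OF hol on_disk_outside int bd]
  show "on_disk (\<lambda>z. g z * f z) \<in> bergman_space"
    by (rule *(1)) auto
  have "sqnorm (on_disk (\<lambda>z. g z * f z)) \<le> (\<integral>z. B\<^sup>2 * (cmod (f z))\<^sup>2 \<partial>lborel)"
    by (rule *(2)) auto
  then show "sqnorm (on_disk (\<lambda>z. g z * f z)) \<le> B\<^sup>2 * sqnorm f"
    by (simp add: sqnorm_def)
qed

text \<open>
  The factor \<open>pi\<close> is the area of the disk.
\<close>
lemma bergman_bounded:
  assumes g: "g holomorphic_on ball 0 1" and B: "\<And>z. z \<in> ball 0 1 \<Longrightarrow> cmod (g z) \<le> B"
  shows "on_disk g \<in> bergman_space" and "sqnorm (on_disk g) \<le> B\<^sup>2 * pi"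
proof -
  have bd: "(cmod (on_disk g z))\<^sup>2 \<le> B\<^sup>2 * indicat_real (ball 0 1) z" for z
    using B[of z] by (auto simp: on_disk_def intro!: power_mono)
  have int: "integrable lborel (\<lambda>z::complex. B\<^sup>2 * indicat_real (ball 0 1) z)"
    using emeasure_lborel_ball_finite[of "0::complex" 1]
    by (intro integrable_mult_right integrable_real_indicator) auto
  note * = bergman_dominated[OF on_disk_holomorphic[OF g] on_disk_outside int bd]
  show "on_disk g \<in> bergman_space"
    by (rule *(1)) auto
  have "sqnorm (on_disk g) \<le> (\<integral>z. B\<^sup>2 * indicat_real (ball 0 1) (z :: complex) \<partial>lborel)"
    by (rule *(2)) auto
  also have "\<dots> = B\<^sup>2 * pi"
    by (simp add: content_ball unit_ball_vol_2)
  finally show "sqnorm (on_disk g) \<le> B\<^sup>2 * pi" .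
qed

text \<open>
  By continuity the zero set contains all of \<open>U\<close>, because a nonempty open set has positive
  area; the identity theorem then propagates the zero to the whole disk.
\<close>
lemma bergman_eq_0_if_AE_0_on_open:
  assumes f: "f \<in> bergman_space" and 0: "AE z in lborel. z \<in> U \<longrightarrow> f z = 0"
    and U: "open U" "U \<subseteq> ball 0 1" "U \<noteq> {}"
  shows "f = (\<lambda>z. 0)"
proof -
  have cont: "continuous_on U f"
    using bergman_holomorphic[OF f] U holomorphic_on_imp_continuous_on continuous_on_subset by blast
  have op: "open {z \<in> U. f z \<noteq> 0}"
  proof -
    have "open (U \<inter> f -` (- {0}))"
      by (rule continuous_open_preimage[OF cont \<open>open U\<close>]) auto
    moreover have "U \<inter> f -` (- {0}) = {z \<in> U. f z \<noteq> 0}" by auto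
    ultimately show ?thesis by simp
  qed
  have "AE z in lborel. z \<notin> {z \<in> U. f z \<noteq> 0}"
    using 0 by eventually_elim auto
  then have "{z \<in> U. f z \<noteq> 0} \<in> null_sets lborel"
    using op by (subst AE_iff_null_sets) auto
  then have "negligible {z \<in> U. f z \<noteq> 0}"
    by (simp add: negligible_iff_null_sets null_sets_completionI)
  then have "{z \<in> U. f z \<noteq> 0} = {}"
    using op open_not_negligible by blast
  then have fU: "f z = 0" if "z \<in> U" for z
    using that by blast
  have "f z = 0" if "z \<in> ball 0 1" for z
    by (rule analytic_continuation_open[of U "ball 0 1" f "\<lambda>_. 0"])
       (use U fU that bergman_holomorphic[OF f] in auto)
  then show ?thesis
    using bergman_outside[OF f] by blast
qed

section \<open>Affine substitution and the inner product\<close>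

text \<open>
  The affine substitution multiplies area by the square of its ratio. It serves twice: for
  the composition operator itself and for dilations about the origin.
\<close>
lemma integral_affine:
  fixes F :: "complex \<Rightarrow> real" and t :: complex
  assumes F: "integrable lborel F" and c: "c > 0"
  shows "integrable lborel (\<lambda>z. F (t + of_real c * z))"
    and "c\<^sup>2 * (\<integral>z. F (t + of_real c * z) \<partial>lborel) = (\<integral>z. F z \<partial>lborel)"
proof -
  have eq: "(lborel :: complex measure) = density (distr lborel borel (\<lambda>x. t + of_real c * x)) (\<lambda>_. ennreal (c\<^sup>2))"
    using lborel_affine[of c t] c by (simp add: scaleR_conv_of_real ennreal_power)
  have [measurable]: "F \<in> borel_measurable borel"
    using F by auto
  have "integrable (density (distr lborel borel (\<lambda>x. t + of_real c * x)) (\<lambda>_. ennreal (c\<^sup>2))) F"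
    using F eq by simp
  then have "integrable (distr lborel borel (\<lambda>x. t + of_real c * x)) (\<lambda>z. c\<^sup>2 * F z)"
    by (subst (asm) integrable_density) auto
  then show "integrable lborel (\<lambda>z. F (t + of_real c * z))"
    using c by (subst (asm) integrable_distr_eq) auto
  have "(\<integral>z. F z \<partial>lborel) = (\<integral>z. F z \<partial>density (distr lborel borel (\<lambda>x. t + of_real c * x)) (\<lambda>_. ennreal (c\<^sup>2)))"
    using eq by simp
  also have "\<dots> = c\<^sup>2 * (\<integral>z. F (t + of_real c * z) \<partial>lborel)"
    by (subst integral_density) (auto simp: integral_distr)
  finally show "c\<^sup>2 * (\<integral>z. F (t + of_real c * z) \<partial>lborel) = (\<integral>z. F z \<partial>lborel)" by simp
qed

definition inner_L2 :: "(complex \<Rightarrow> complex) \<Rightarrow> (complex \<Rightarrow> complex) \<Rightarrow> complex" where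
  "inner_L2 f g = (\<integral>z. f z * cnj (g z) \<partial>lborel)"

lemma inner_L2_integrable:
  assumes f: "f \<in> bergman_space" and g: "g \<in> bergman_space"
  shows "integrable lborel (\<lambda>z. f z * cnj (g z))"
proof (rule Bochner_Integration.integrable_bound)
  show "integrable lborel (\<lambda>z. (cmod (f z))\<^sup>2 + (cmod (g z))\<^sup>2)"
    using assms by (auto simp: bergman_integrable)
  have [measurable]: "f \<in> borel_measurable borel" "g \<in> borel_measurable borel"
    using assms bergman_measurable by auto
  show "(\<lambda>z. f z * cnj (g z)) \<in> borel_measurable lborel"
    by (auto intro!: borel_measurable_times
        borel_measurable_continuous_on[where f = cnj] continuous_intros)
  have "cmod (f z) * cmod (g z) \<le> (cmod (f z))\<^sup>2 + (cmod (g z))\<^sup>2" for z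
    using sum_squares_bound[of "cmod (f z)" "cmod (g z)"]
      mult_nonneg_nonneg[OF norm_ge_zero norm_ge_zero, of "f z" "g z"] by linarith
  then show "AE z in lborel. norm (f z * cnj (g z)) \<le> norm ((cmod (f z))\<^sup>2 + (cmod (g z))\<^sup>2)"
    by (auto simp: norm_mult)
qed

lemma inner_L2_self: "inner_L2 f f = of_real (sqnorm f)"
  unfolding inner_L2_def sqnorm_def
  by (subst integral_complex_of_real[symmetric]) (simp only: complex_norm_square)

text \<open>
  Cauchy--Schwarz, brought over from its version for nonnegative integrals.
\<close>
lemma inner_L2_le:
  assumes f: "f \<in> bergman_space" and g: "g \<in> bergman_space"
  shows "cmod (inner_L2 f g) \<le> sqrt (sqnorm f) * sqrt (sqnorm g)"
proof -
  have [measurable]: "f \<in> borel_measurable borel" "g \<in> borel_measurable borel"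
    using assms bergman_measurable by auto
  have int: "integrable lborel (\<lambda>z. cmod (f z) * cmod (g z))"
    using integrable_norm[OF inner_L2_integrable[OF f g]] by (simp add: norm_mult)
  define I where "I = (\<integral>z. cmod (f z) * cmod (g z) \<partial>lborel)"
  have "0 \<le> I" unfolding I_def by (rule integral_nonneg_AE) auto
  have sq: "(\<integral>\<^sup>+z. (ennreal (cmod (h z)))\<^sup>2 \<partial>lborel) = ennreal (sqnorm h)" if "h \<in> bergman_space" for h
    unfolding sqnorm_def
    by (subst nn_integral_eq_integral[symmetric])
       (use bergman_integrable[OF that] in \<open>auto simp: ennreal_power\<close>)
  have "(\<integral>\<^sup>+z. ennreal (cmod (f z)) * ennreal (cmod (g z)) \<partial>lborel) = ennreal I"
    unfolding I_def
    by (subst nn_integral_eq_integral[symmetric]) (use int in \<open>auto simp: ennreal_mult\<close>)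
  then have "ennreal I ^ 2 \<le> ennreal (sqnorm f) * ennreal (sqnorm g)"
    using Cauchy_Schwarz_nn_integral[of "\<lambda>z. ennreal (cmod (f z))" lborel "\<lambda>z. ennreal (cmod (g z))"]
    by (simp add: sq f g)
  then have "ennreal (I\<^sup>2) \<le> ennreal (sqnorm f * sqnorm g)"
    using \<open>0 \<le> I\<close> by (simp add: ennreal_power ennreal_mult)
  then have "I\<^sup>2 \<le> sqnorm f * sqnorm g"
    by (simp add: ennreal_le_iff)
  then have "I \<le> sqrt (sqnorm f * sqnorm g)"
    by (rule real_le_rsqrt)
  moreover have "cmod (inner_L2 f g) \<le> I"
    unfolding inner_L2_def I_def using integral_norm_bound[of lborel "\<lambda>z. f z * cnj (g z)"]
    by (simp add: norm_mult)
  ultimately show ?thesis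
    by (simp add: real_sqrt_mult)
qed

section \<open>Complex powers of $1-z$ in the Bergman space\<close>

text \<open>
  The singularity \<open>z = 1\<close> lies on the boundary circle. On the dyadic annulus
  \<open>2^(-n) \<le> cmod (1 - z) < 2 * 2^(-n)\<close> the integrand is of size \<open>2 powr (-b n)\<close> while the area is of
  size \<open>4^(-n)\<close>, so the integral is dominated by a geometric series of ratio \<open>2 powr (-b) / 4\<close>,
  which is less than 1 exactly because \<open>b > -2\<close>.
\<close>
lemma integrable_disk_dist_powr:
  assumes "b > -2"
  shows "integrable lborel (\<lambda>z::complex. indicat_real (ball 0 1) z * cmod (1 - z) powr b)"
proof (rule integrableI_bounded)
  show "(\<lambda>z::complex. indicat_real (ball 0 1) z * cmod (1 - z) powr b) \<in> borel_measurable lborel"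
  proof -
    have "(\<lambda>z::complex. cmod (1 - z) powr b) \<in> borel_measurable borel"
      by (intro powr_real_measurable borel_measurable_const borel_measurable_continuous_onI continuous_intros)
    then show ?thesis
      by (intro borel_measurable_times borel_measurable_indicator) auto
  qed
  define c :: "nat \<Rightarrow> real" where "c n = 2 powr \<bar>b\<bar> * (2 powr (-b)) ^ n" for n
  have c0: "0 \<le> c n" for n by (simp add: c_def)
  define B :: "nat \<Rightarrow> complex set" where "B n = ball 1 (2 * (1/2) ^ n)" for n
  have [measurable]: "B n \<in> sets borel" for n by (simp add: B_def)
  have point: "ennreal (indicat_real (ball 0 1) z * cmod (1 - z) powr b) \<le> (\<Sum>n. ennreal (c n) * indicator (B n) z)"
    for z :: complex
  proof (cases "z \<in> ball 0 1")
    case True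
    define x where "x = cmod (1 - z)"
    have "z \<noteq> 1" using True by auto
    then have "x > 0" by (simp add: x_def)
    have "x < 2" using True norm_triangle_ineq4[of 1 z] by (simp add: x_def)
    define n where "n = nat \<lceil>- log 2 x\<rceil>"
    have "log 2 x < 1" using \<open>x > 0\<close> \<open>x < 2\<close> by (simp add: log_less_iff)
    then have "real n = of_int \<lceil>- log 2 x\<rceil>"
      by (simp add: n_def)
    then have n: "- real n \<le> log 2 x" "log 2 x < 1 - real n"
      by linarith+
    have pw: "(1/2) ^ n = (2::real) powr (- real n)"
      by (simp add: powr_minus powr_realpow power_divide field_simps)
    have lower: "(1/2) ^ n \<le> x"
      using n(1) \<open>x > 0\<close> by (simp add: pw le_log_iff)
    have "x < 2 powr (1 - real n)"
      using n(2) \<open>x > 0\<close> by (simp add: log_less_iff)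
    then have upper: "x < 2 * (1/2) ^ n"
      by (simp add: pw powr_diff powr_minus powr_realpow field_simps)
    have q: "((1/2) ^ n) powr b = (2 powr (-b)) ^ n"
      unfolding pw by (simp add: powr_powr powr_realpow[symmetric] mult.commute)
    have "x powr b \<le> c n"
    proof (cases "b \<ge> 0")
      case True
      have "x powr b \<le> (2 * (1/2) ^ n) powr b"
        using upper \<open>x > 0\<close> True by (intro powr_mono2) auto
      also have "\<dots> = c n"
        using True by (simp only: powr_mult q c_def abs_of_nonneg)
      finally show ?thesis .
    next
      case False
      have "x powr b \<le> ((1/2) ^ n) powr b"
        using lower False by (intro powr_mono2') auto
      also have "\<dots> \<le> c n"
        unfolding q c_def using mult_right_mono[of 1 "2 powr \<bar>b\<bar>" "(2 powr (-b)) ^ n"]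
        by (simp add: ge_one_powr_ge_zero)
      finally show ?thesis .
    qed
    moreover have "z \<in> B n"
      using upper by (simp add: B_def x_def dist_norm)
    ultimately have "ennreal (indicat_real (ball 0 1) z * cmod (1 - z) powr b) \<le> (\<Sum>i\<in>{n}. ennreal (c i) * indicator (B i) z)"
      using True by (simp add: x_def ennreal_leI)
    also have "\<dots> \<le> (\<Sum>n. ennreal (c n) * indicator (B n) z)"
      by (intro sum_le_suminf) auto
    finally show ?thesis .
  qed auto
  define q :: real where "q = 2 powr (-b) / 4"
  have "2 powr (-b) < (2::real) powr 2"
    using assms by (intro powr_less_mono) auto
  then have q: "0 \<le> q" "q < 1"
    by (auto simp: q_def)
  have em: "ennreal (c n) * emeasure lborel (B n) = ennreal (2 powr \<bar>b\<bar> * 4 * pi * q ^ n)" for n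
  proof -
    have "emeasure lborel (B n) = ennreal (pi * (2 * (1/2) ^ n)\<^sup>2)"
      unfolding B_def by (subst emeasure_ball) (auto simp: unit_ball_vol_2)
    moreover have "c n * (pi * (2 * (1/2) ^ n)\<^sup>2) = 2 powr \<bar>b\<bar> * 4 * pi * q ^ n"
      by (simp add: c_def q_def power_mult_distrib power_divide power2_eq_square)
         (simp add: power_mult_distrib[symmetric])
    ultimately show ?thesis
      using c0[of n] by (metis ennreal_mult')
  qed
  have "(\<integral>\<^sup>+z. ennreal (norm (indicat_real (ball 0 1) z * cmod (1 - z) powr b)) \<partial>lborel)
      \<le> (\<integral>\<^sup>+z. (\<Sum>n. ennreal (c n) * indicator (B n) z) \<partial>lborel)"
    by (rule nn_integral_mono) (use point in \<open>simp add: abs_mult\<close>)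
  also have "\<dots> = (\<Sum>n. \<integral>\<^sup>+z. ennreal (c n) * indicator (B n) z \<partial>lborel)"
    by (rule nn_integral_suminf) measurable
  also have "\<dots> = (\<Sum>n. ennreal (2 powr \<bar>b\<bar> * 4 * pi * q ^ n))"
    by (subst nn_integral_cmult_indicator) (auto simp: B_def em[unfolded B_def])
  also have "\<dots> = ennreal (\<Sum>n. 2 powr \<bar>b\<bar> * 4 * pi * q ^ n)"
    using q by (intro suminf_ennreal2 summable_mult summable_geometric) auto
  also have "\<dots> < \<infinity>" by simp
  finally show "(\<integral>\<^sup>+z. ennreal (norm (indicat_real (ball 0 1) z * cmod (1 - z) powr b)) \<partial>lborel) < \<infinity>" .
qed

definition dist_powr_integral :: "real \<Rightarrow> real" where
  "dist_powr_integral a = (\<integral>z. indicat_real (ball 0 1) (z :: complex) * cmod (1 - z) powr (2 * a) \<partial>lborel)"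

text \<open>
  Membership and smallness in the Bergman space are read off from pointwise bounds by a power
  of the distance to 1, uniformly in the function through the constant \<open>C\<close>.
\<close>
lemma bergman_powr_bounded:
  assumes g: "g holomorphic_on ball 0 1" and a: "a > -1"
    and C: "\<And>z. z \<in> ball 0 1 \<Longrightarrow> cmod (g z) \<le> C * cmod (1 - z) powr a"
  shows "on_disk g \<in> bergman_space" and "sqnorm (on_disk g) \<le> C\<^sup>2 * dist_powr_integral a"
proof -
  have bd: "(cmod (on_disk g z))\<^sup>2 \<le> C\<^sup>2 * (indicat_real (ball 0 1) z * cmod (1 - z) powr (2 * a))" for z
  proof (cases "z \<in> ball 0 1")
    case True
    then have "(cmod (g z))\<^sup>2 \<le> (C * cmod (1 - z) powr a)\<^sup>2"
      using C by (intro power_mono) auto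
    also have "\<dots> = C\<^sup>2 * cmod (1 - z) powr (2 * a)"
      by (simp add: power_mult_distrib power2_eq_square powr_add[symmetric])
    finally show ?thesis using True by simp
  qed auto
  have int: "integrable lborel (\<lambda>z. C\<^sup>2 * (indicat_real (ball 0 1) (z :: complex) * cmod (1 - z) powr (2 * a)))"
    using a by (intro integrable_mult_right integrable_disk_dist_powr) auto
  note * = bergman_dominated[OF on_disk_holomorphic[OF g] on_disk_outside int bd]
  show "on_disk g \<in> bergman_space"
    by (rule *(1)) auto
  have "sqnorm (on_disk g) \<le> (\<integral>z. C\<^sup>2 * (indicat_real (ball 0 1) (z :: complex) * cmod (1 - z) powr (2 * a)) \<partial>lborel)"
    by (rule *(2)) auto
  then show "sqnorm (on_disk g) \<le> C\<^sup>2 * dist_powr_integral a"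
    by (simp add: dist_powr_integral_def)
qed

text \<open>
  The function $(1-z)^s$ (principal branch), an eigenvector of the composition operator.
\<close>
definition cpower :: "complex \<Rightarrow> complex \<Rightarrow> complex" where
  "cpower s = on_disk (\<lambda>z. exp (s * Ln (1 - z)))"

lemma disk_complement_pos:
  assumes "z \<in> ball 0 1"
  shows "Re (1 - z) > 0" and "1 - z \<noteq> 0" and "1 - z \<notin> \<real>\<^sub>\<le>\<^sub>0" and "cmod (1 - z) \<le> 2"
proof -
  show *: "Re (1 - z) > 0"
    using assms abs_Re_le_cmod[of z] by auto
  then show "1 - z \<noteq> 0" by auto
  show "1 - z \<notin> \<real>\<^sub>\<le>\<^sub>0"
    using * by (auto simp: complex_nonpos_Reals_iff)
  show "cmod (1 - z) \<le> 2"
    using assms norm_triangle_ineq4[of 1 z] by simp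
qed

lemma holomorphic_Ln_disk: "(\<lambda>z. Ln (1 - z)) holomorphic_on ball 0 1"
  by (intro holomorphic_intros disk_complement_pos(3))

lemma norm_exp_mult_Ln_le:
  assumes "w \<noteq> 0"
  shows "cmod (exp (s * Ln w)) \<le> exp (\<bar>Im s\<bar> * pi) * cmod w powr Re s"
proof -
  have "\<bar>Im (Ln w)\<bar> \<le> pi"
    using mpi_less_Im_Ln[OF assms] Im_Ln_le_pi[OF assms] by linarith
  then have "\<bar>Im s\<bar> * \<bar>Im (Ln w)\<bar> \<le> \<bar>Im s\<bar> * pi"
    by (intro mult_left_mono) auto
  then have "- (Im s * Im (Ln w)) \<le> \<bar>Im s\<bar> * pi"
    using abs_ge_minus_self[of "Im s * Im (Ln w)"] by (simp add: abs_mult)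
  then have "Re (s * Ln w) \<le> \<bar>Im s\<bar> * pi + Re s * ln (cmod w)"
    using assms by simp
  then show ?thesis
    using assms by (simp add: powr_def exp_add[symmetric] del: Re_Ln)
qed

text \<open>
  Since \<open>cmod w \<le> 2\<close>, the modulus of \<open>Ln w\<close> exceeds \<open>- ln (cmod w)\<close> by at most a constant. So powers
  of the logarithm, and even small exponentials of it, cost only an arbitrarily small negative
  power of \<open>cmod w\<close>.
\<close>
lemma exp_norm_Ln_le:
  assumes "w \<noteq> 0" and "cmod w \<le> 2" and "c \<ge> 0"
  shows "exp (c * cmod (Ln w)) \<le> exp (c * (pi + 2 * ln 2)) * cmod w powr (- c)"
proof -
  have im: "\<bar>Im (Ln w)\<bar> \<le> pi"
    using mpi_less_Im_Ln[OF assms(1)] Im_Ln_le_pi[OF assms(1)] by linarith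
  have "ln (cmod w) \<le> ln 2" "0 < ln (2::real)"
    using assms by auto
  then have "\<bar>ln (cmod w)\<bar> \<le> 2 * ln 2 - ln (cmod w)"
    by linarith
  then have "cmod (Ln w) \<le> (pi + 2 * ln 2) - ln (cmod w)"
    using cmod_le[of "Ln w"] im assms by (simp add: Re_Ln)
  then have "c * cmod (Ln w) \<le> c * ((pi + 2 * ln 2) - ln (cmod w))"
    by (rule mult_left_mono) (rule assms)
  then have "exp (c * cmod (Ln w)) \<le> exp (c * (pi + 2 * ln 2) + (- c) * ln (cmod w))"
    by (simp add: right_diff_distrib)
  also have "\<dots> = exp (c * (pi + 2 * ln 2)) * cmod w powr (- c)"
    unfolding exp_add using assms by (simp add: powr_def)
  finally show ?thesis .
qed

lemma cpower_in_bergman: "Re s > -1 \<Longrightarrow> cpower s \<in> bergman_space"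
  unfolding cpower_def
  by (rule bergman_powr_bounded(1)[where C = "exp (\<bar>Im s\<bar> * pi)"])
     (auto intro!: holomorphic_intros holomorphic_Ln_disk norm_exp_mult_Ln_le disk_complement_pos(3)
       dest: disk_complement_pos(2) simp del: Re_Ln norm_exp_eq_Re)

lemma cpower_nat: "cpower (of_nat m) = on_disk (\<lambda>z. (1 - z) ^ m)"
  unfolding cpower_def on_disk_def
  using disk_complement_pos(2) by (auto simp: fun_eq_iff exp_of_nat_mult)

definition cpower_deriv :: "complex \<Rightarrow> complex \<Rightarrow> complex" where
  "cpower_deriv s = on_disk (\<lambda>z. Ln (1 - z) * exp (s * Ln (1 - z)))"

lemma cpower_deriv_in_bergman:
  assumes "Re s > -1"
  shows "cpower_deriv s \<in> bergman_space"
proof -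
  define e where "e = (Re s + 1) / 2"
  have e: "e > 0" "Re s - e > -1" using assms by (auto simp: e_def field_simps)
  define C where "C = exp (e * (pi + 2 * ln 2)) * exp (\<bar>Im s\<bar> * pi) / e"
  show ?thesis
    unfolding cpower_deriv_def
  proof (rule bergman_powr_bounded(1)[where C = C and a = "Re s - e"])
    show "(\<lambda>z. Ln (1 - z) * exp (s * Ln (1 - z))) holomorphic_on ball 0 1"
      by (intro holomorphic_intros holomorphic_Ln_disk disk_complement_pos(3))
    fix z :: complex assume z: "z \<in> ball 0 1"
    define w where "w = 1 - z"
    have w: "w \<noteq> 0" "cmod w \<le> 2" using disk_complement_pos[OF z] by (auto simp: w_def)
    have "e * cmod (Ln w) \<le> exp (e * cmod (Ln w))"
      using exp_ge_add_one_self[of "e * cmod (Ln w)"] by linarith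
    also have "\<dots> \<le> exp (e * (pi + 2 * ln 2)) * cmod w powr (- e)"
      using exp_norm_Ln_le[OF w, of e] e by simp
    finally have "cmod (Ln w) \<le> exp (e * (pi + 2 * ln 2)) * cmod w powr (- e) / e"
      using e by (simp add: field_simps)
    then have "cmod (Ln w * exp (s * Ln w)) \<le>
        (exp (e * (pi + 2 * ln 2)) * cmod w powr (- e) / e) * (exp (\<bar>Im s\<bar> * pi) * cmod w powr Re s)"
      unfolding norm_mult using norm_exp_mult_Ln_le[OF w(1), of s] e by (intro mult_mono) auto
    also have "\<dots> = C * cmod w powr (Re s - e)"
      by (simp add: C_def powr_diff powr_minus field_simps)
    finally show "cmod (Ln (1 - z) * exp (s * Ln (1 - z))) \<le> C * cmod (1 - z) powr (Re s - e)"
      by (simp add: w_def)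
  qed (use e in auto)
qed

lemma norm_exp_remainder_le: "cmod (exp x - 1 - x) \<le> exp (cmod x) * (cmod x)\<^sup>2"
proof -
  have "cmod (exp x - (\<Sum>k\<le>1. x ^ k / fact k)) \<le> exp \<bar>Re x\<bar> * cmod x ^ Suc 1 / fact 1"
    by (rule Taylor_exp)
  also have "\<dots> \<le> exp (cmod x) * (cmod x)\<^sup>2"
    using abs_Re_le_cmod[of x] by (auto simp: power2_eq_square intro!: mult_right_mono)
  finally show ?thesis by (simp add: diff_diff_eq)
qed

text \<open>
  The curve \<open>s \<mapsto> cpower s\<close> is complex differentiable in the Bergman norm: the factor
  \<open>exp (h l) - 1 - h l\<close> with \<open>l = Ln (1 - z)\<close> is of second order in \<open>h\<close>, and the growth in \<open>l\<close> that
  comes with it costs only a small power of the distance to 1.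
\<close>
lemma cpower_remainder:
  assumes "Re s > -1"
  obtains e M where "e > 0" and
    "\<And>h. cmod h \<le> e \<Longrightarrow> sqrt (sqnorm (\<lambda>z. cpower (s + h) z - cpower s z - h * cpower_deriv s z)) \<le> M * (cmod h)\<^sup>2"
proof -
  \<comment> \<open>Absorbing both \<open>l\<^sup>2\<close> and \<open>exp (cmod h * l)\<close> costs the power \<open>2 e\<close>; this keeps the exponent
    \<open>Re s - 2 * e\<close> halfway between \<open>-1\<close> and \<open>Re s\<close>.\<close>
  define e where "e = (Re s + 1) / 4"
  have e: "e > 0" "Re s - 2 * e > -1" using assms by (auto simp: e_def field_simps)
  define C where "C = (2 / e\<^sup>2) * exp (2 * e * (pi + 2 * ln 2)) * exp (\<bar>Im s\<bar> * pi)"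
  have "0 \<le> C" by (simp add: C_def)
  have "sqrt (sqnorm (\<lambda>z. cpower (s + h) z - cpower s z - h * cpower_deriv s z))
      \<le> (C * sqrt (dist_powr_integral (Re s - 2 * e))) * (cmod h)\<^sup>2" if h: "cmod h \<le> e" for h
  proof -
    define g where "g = (\<lambda>z. exp ((s + h) * Ln (1 - z)) - exp (s * Ln (1 - z)) - h * (Ln (1 - z) * exp (s * Ln (1 - z))))"
    have eq: "(\<lambda>z. cpower (s + h) z - cpower s z - h * cpower_deriv s z) = on_disk g"
      by (auto simp: fun_eq_iff cpower_def cpower_deriv_def on_disk_def g_def)
    have "sqnorm (on_disk g) \<le> (C * (cmod h)\<^sup>2)\<^sup>2 * dist_powr_integral (Re s - 2 * e)"
    proof (rule bergman_powr_bounded(2))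
      show "g holomorphic_on ball 0 1"
        unfolding g_def by (intro holomorphic_intros holomorphic_Ln_disk disk_complement_pos(3))
      fix z :: complex assume z: "z \<in> ball 0 1"
      define w where "w = 1 - z"
      have w: "w \<noteq> 0" "cmod w \<le> 2" using disk_complement_pos[OF z] by (auto simp: w_def)
      define l where "l = cmod (Ln w)"
      have l: "0 \<le> l" by (simp add: l_def)
      have key: "exp (cmod h * l) * l\<^sup>2 \<le> (2 / e\<^sup>2) * (exp (2 * e * (pi + 2 * ln 2)) * cmod w powr (- (2 * e)))"
      proof -
        have "(e * l)\<^sup>2 / 2 \<le> exp (e * l)"
          using exp_lower_Taylor_quadratic[of "e * l"] e l by (smt (verit) mult_nonneg_nonneg)
        then have "l\<^sup>2 \<le> (2 / e\<^sup>2) * exp (e * l)"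
          using e by (simp add: field_simps)
        moreover have "exp (cmod h * l) \<le> exp (e * l)"
          using h l by (simp add: mult_right_mono)
        ultimately have "exp (cmod h * l) * l\<^sup>2 \<le> exp (e * l) * ((2 / e\<^sup>2) * exp (e * l))"
          by (intro mult_mono) auto
        also have "\<dots> = (2 / e\<^sup>2) * exp (2 * e * l)"
        proof -
          have "exp (2 * e * l) = exp (e * l) * exp (e * l)"
            using exp_add[of "e * l" "e * l"] by (simp only: mult_2[symmetric] mult.assoc)
          then show ?thesis by (simp only: mult.left_commute)
        qed
        also have "\<dots> \<le> (2 / e\<^sup>2) * (exp (2 * e * (pi + 2 * ln 2)) * cmod w powr (- (2 * e)))"
          using exp_norm_Ln_le[OF w, of "2 * e"] e by (intro mult_left_mono) (auto simp: l_def)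
        finally show ?thesis .
      qed
      have "g z = exp (s * Ln w) * (exp (h * Ln w) - 1 - h * Ln w)"
        by (simp add: g_def w_def algebra_simps exp_add)
      then have "cmod (g z) \<le> cmod (exp (s * Ln w)) * (exp (cmod (h * Ln w)) * (cmod (h * Ln w))\<^sup>2)"
        unfolding norm_mult using norm_exp_remainder_le[of "h * Ln w"]
        by (metis mult_left_mono norm_ge_zero norm_mult)
      also have "\<dots> = cmod (exp (s * Ln w)) * ((cmod h)\<^sup>2 * (exp (cmod h * l) * l\<^sup>2))"
        by (simp add: norm_mult l_def power_mult_distrib)
      also have "\<dots> \<le> (exp (\<bar>Im s\<bar> * pi) * cmod w powr Re s) *
          ((cmod h)\<^sup>2 * ((2 / e\<^sup>2) * (exp (2 * e * (pi + 2 * ln 2)) * cmod w powr (- (2 * e)))))"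
        by (intro mult_mono[OF norm_exp_mult_Ln_le[OF w(1)] mult_left_mono[OF key]]) auto
      also have "\<dots> = C * (cmod h)\<^sup>2 * cmod w powr (Re s - 2 * e)"
        by (simp add: C_def powr_diff powr_minus field_simps)
      finally show "cmod (g z) \<le> C * (cmod h)\<^sup>2 * cmod (1 - z) powr (Re s - 2 * e)"
        by (simp add: w_def)
    qed (use e in auto)
    then have "sqrt (sqnorm (on_disk g)) \<le> sqrt ((C * (cmod h)\<^sup>2)\<^sup>2 * dist_powr_integral (Re s - 2 * e))"
      by simp
    also have "\<dots> = C * sqrt (dist_powr_integral (Re s - 2 * e)) * (cmod h)\<^sup>2"
      using \<open>0 \<le> C\<close> by (simp add: real_sqrt_mult)
    finally show ?thesis unfolding eq .
  qed
  then show ?thesis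
    using that e(1) by blast
qed

section \<open>The powers with exponents in a strip are total\<close>

definition bounded_functional :: "((complex \<Rightarrow> complex) \<Rightarrow> complex) \<Rightarrow> bool" where
  "bounded_functional L \<longleftrightarrow>
     (\<forall>f\<in>bergman_space. \<forall>g\<in>bergman_space. L (\<lambda>z. f z + g z) = L f + L g) \<and>
     (\<forall>c. \<forall>f\<in>bergman_space. L (\<lambda>z. c * f z) = c * L f) \<and>
     (\<exists>K. \<forall>f\<in>bergman_space. cmod (L f) \<le> K * sqrt (sqnorm f))"

lemma
  assumes "bounded_functional L" and "f \<in> bergman_space"
  shows functional_add: "g \<in> bergman_space \<Longrightarrow> L (\<lambda>z. f z + g z) = L f + L g"
    and functional_scale: "L (\<lambda>z. c * f z) = c * L f"
  using assms by (auto simp: bounded_functional_def)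

lemma functional_diff:
  assumes "bounded_functional L" and "f \<in> bergman_space" and "g \<in> bergman_space"
  shows "L (\<lambda>z. f z - g z) = L f - L g"
  using functional_add[OF assms(1,2) bergman_scale[OF assms(3), of "-1"]]
    functional_scale[OF assms(1,3), of "-1"] by simp

lemma functional_bound:
  assumes "bounded_functional L"
  obtains K where "K \<ge> 0" and "\<And>f. f \<in> bergman_space \<Longrightarrow> cmod (L f) \<le> K * sqrt (sqnorm f)"
proof -
  obtain K where K: "\<And>f. f \<in> bergman_space \<Longrightarrow> cmod (L f) \<le> K * sqrt (sqnorm f)"
    using assms unfolding bounded_functional_def by blast
  have "cmod (L f) \<le> \<bar>K\<bar> * sqrt (sqnorm f)" if "f \<in> bergman_space" for f
    by (intro order_trans[OF K[OF that]] mult_right_mono) auto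
  then show ?thesis by (intro that[of "\<bar>K\<bar>"]) auto
qed

lemma functional_zero_limit:
  assumes L: "bounded_functional L" and f: "f \<in> bergman_space"
    and fn: "\<And>n. fn n \<in> bergman_space" "\<And>n. L (fn n) = 0"
    and lim: "(\<lambda>n. sqnorm (\<lambda>z. fn n z - f z)) \<longlonglongrightarrow> 0"
  shows "L f = 0"
proof -
  obtain K where K: "K \<ge> 0" "\<And>f. f \<in> bergman_space \<Longrightarrow> cmod (L f) \<le> K * sqrt (sqnorm f)"
    using functional_bound[OF L] by blast
  have "cmod (L f) \<le> K * sqrt (sqnorm (\<lambda>z. fn n z - f z))" for n
    using K(2)[OF bergman_diff[OF fn(1) f]] functional_diff[OF L fn(1) f, of n] fn(2)[of n]
    by (metis diff_0 norm_minus_cancel)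
  moreover have "(\<lambda>n. K * sqrt (sqnorm (\<lambda>z. fn n z - f z))) \<longlonglongrightarrow> K * sqrt 0"
    by (intro tendsto_intros lim)
  ultimately have "cmod (L f) \<le> K * sqrt 0"
    by (intro LIMSEQ_le_const) auto
  then show ?thesis by simp
qed

lemma functional_cpower_holomorphic:
  assumes L: "bounded_functional L"
  shows "(\<lambda>s. L (cpower s)) holomorphic_on {s. Re s > -1}"
proof (rule holomorphic_onI)
  fix s assume "s \<in> {s. Re s > -1}"
  then have s: "Re s > -1" by simp
  obtain K where K: "K \<ge> 0" "\<And>f. f \<in> bergman_space \<Longrightarrow> cmod (L f) \<le> K * sqrt (sqnorm f)"
    using functional_bound[OF L] by blast
  obtain e M where e: "e > 0" and M: "\<And>h. cmod h \<le> e \<Longrightarrow>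
      sqrt (sqnorm (\<lambda>z. cpower (s + h) z - cpower s z - h * cpower_deriv s z)) \<le> M * (cmod h)\<^sup>2"
    using cpower_remainder[OF s] by blast
  define D where "D = L (cpower_deriv s)"
  define d where "d = min e (Re s + 1)"
  have d: "d > 0" using e s by (simp add: d_def)
  have bound: "cmod ((L (cpower (s + h)) - L (cpower s)) / h - D) \<le> K * M * cmod h"
    if h: "h \<noteq> 0" "cmod h < d" for h
  proof -
    have "Re (s + h) > -1"
      using h abs_Re_le_cmod[of h] by (auto simp: d_def)
    note in_H = cpower_in_bergman[OF this] cpower_in_bergman[OF s] cpower_deriv_in_bergman[OF s]
    have "L (\<lambda>z. cpower (s + h) z - cpower s z - h * cpower_deriv s z) = L (cpower (s + h)) - L (cpower s) - h * D"
      unfolding D_def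
      by (simp add: functional_diff[OF L] functional_scale[OF L] in_H bergman_diff bergman_scale)
    moreover have "(\<lambda>z. cpower (s + h) z - cpower s z - h * cpower_deriv s z) \<in> bergman_space"
      by (intro bergman_diff bergman_scale in_H)
    ultimately have "cmod (L (cpower (s + h)) - L (cpower s) - h * D) \<le> K * (M * (cmod h)\<^sup>2)"
      using K M[of h] h by (smt (verit) d_def mult_left_mono)
    moreover have "(L (cpower (s + h)) - L (cpower s)) / h - D = (L (cpower (s + h)) - L (cpower s) - h * D) / h"
      using h by (simp add: field_simps)
    ultimately show ?thesis
      using h by (simp add: norm_divide field_simps power2_eq_square)
  qed
  have "((\<lambda>h. (L (cpower (s + h)) - L (cpower s)) / h - D) \<longlongrightarrow> 0) (at 0)"
  proof (rule Lim_null_comparison)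
    show "\<forall>\<^sub>F h in at 0. cmod ((L (cpower (s + h)) - L (cpower s)) / h - D) \<le> K * M * cmod h"
      unfolding eventually_at using d bound by (auto intro!: exI[of _ d] simp: dist_norm)
    show "((\<lambda>h. K * M * cmod h) \<longlongrightarrow> 0) (at (0::complex))"
      by (rule tendsto_eq_intros | simp)+
  qed
  then have "((\<lambda>s. L (cpower s)) has_field_derivative D) (at s)"
    unfolding DERIV_def using LIM_zero_iff by blast
  then show "(\<lambda>s. L (cpower s)) field_differentiable at s within {s. Re s > -1}"
    using field_differentiable_at_within field_differentiable_def by blast
qed

text \<open>
  Identity theorem on the half plane of admissible exponents.
\<close>
lemma functional_cpower_zero:
  assumes L: "bounded_functional L" and "\<delta> > 0"
    and zero: "\<And>s. -1 < Re s \<Longrightarrow> Re s < -1 + \<delta> \<Longrightarrow> L (cpower s) = 0"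
    and s: "Re s > -1"
  shows "L (cpower s) = 0"
proof (rule analytic_continuation_open[of "{s. -1 < Re s} \<inter> {s. Re s < -1 + \<delta>}" "{s. Re s > -1}" "\<lambda>s. L (cpower s)" "\<lambda>_. 0"])
  show "open ({s. -1 < Re s} \<inter> {s. Re s < -1 + \<delta>})"
    by (intro open_Int open_halfspace_Re_gt open_halfspace_Re_lt)
  have "complex_of_real (-1 + \<delta> / 2) \<in> {s. -1 < Re s} \<inter> {s. Re s < -1 + \<delta>}"
    using \<open>\<delta> > 0\<close> by auto
  then show "{s. -1 < Re s} \<inter> {s. Re s < -1 + \<delta>} \<noteq> {}"
    by blast
  show "connected {s. -1 < Re s}"
    by (intro convex_connected convex_halfspace_Re_gt)
qed (use zero s functional_cpower_holomorphic[OF L] in \<open>auto simp: open_halfspace_Re_gt\<close>)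

text \<open>
  From powers of \<open>1 - z\<close> to powers of \<open>z\<close>: multiplication by \<open>z\<close> is the identity minus
  multiplication by \<open>1 - z\<close>, and the induction runs with all exponents \<open>m\<close> at once.
\<close>
lemma functional_monomials_zero:
  assumes L: "bounded_functional L" and zero: "\<And>m. L (cpower (of_nat m)) = 0"
  shows "L (on_disk (\<lambda>z. (1 - z) ^ m * z ^ k)) = 0"
proof (induction k arbitrary: m)
  case 0
  then show ?case using zero[of m] by (simp add: cpower_nat)
next
  case (Suc k)
  have H: "on_disk (\<lambda>z. (1 - z) ^ m * z ^ k) \<in> bergman_space" for m
  proof (rule bergman_bounded(1)[where B = "2 ^ m"])
    fix z :: complex assume z: "z \<in> ball 0 1"
    have "cmod (1 - z) ^ m * cmod z ^ k \<le> 2 ^ m * 1"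
      using z disk_complement_pos(4)[OF z] by (intro mult_mono power_mono power_le_one) auto
    then show "cmod ((1 - z) ^ m * z ^ k) \<le> 2 ^ m"
      by (simp add: norm_mult norm_power)
  qed (auto intro!: holomorphic_intros)
  have "on_disk (\<lambda>z. (1 - z) ^ m * z ^ Suc k) =
      (\<lambda>z. on_disk (\<lambda>z. (1 - z) ^ m * z ^ k) z - on_disk (\<lambda>z. (1 - z) ^ Suc m * z ^ k) z)"
    by (auto simp: fun_eq_iff on_disk_def algebra_simps)
  then show ?case
    using functional_diff[OF L H[of m] H[of "Suc m"]] Suc.IH[of m] Suc.IH[of "Suc m"] by simp
qed

lemma functional_polynomials_zero:
  assumes L: "bounded_functional L" and zero: "\<And>k. L (on_disk (\<lambda>z. z ^ k)) = 0"
  shows "on_disk (\<lambda>z. \<Sum>i<n. a i * z ^ i) \<in> bergman_space \<and> L (on_disk (\<lambda>z. \<Sum>i<n. a i * z ^ i)) = 0"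
proof (induction n)
  case 0
  have H: "(\<lambda>z. 0) \<in> bergman_space"
    by (simp add: bergman_space_iff)
  moreover have "L (\<lambda>z. 0) = 0"
    using functional_scale[OF L H, of 0] by simp
  moreover have "on_disk (\<lambda>z. \<Sum>i<0. a i * z ^ i) = (\<lambda>z. 0)"
    by (auto simp: on_disk_def)
  ultimately show ?case by simp
next
  case (Suc n)
  have H: "on_disk (\<lambda>z. z ^ n) \<in> bergman_space"
    by (rule bergman_bounded(1)[where B = 1])
       (auto intro!: holomorphic_intros power_le_one simp: norm_power)
  have "on_disk (\<lambda>z. \<Sum>i<Suc n. a i * z ^ i) =
      (\<lambda>z. on_disk (\<lambda>z. \<Sum>i<n. a i * z ^ i) z + a n * on_disk (\<lambda>z. z ^ n) z)"
    by (auto simp: fun_eq_iff on_disk_def)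
  then show ?case
    using Suc functional_add[OF L conjunct1[OF Suc] bergman_scale[OF H, of "a n"]]
      functional_scale[OF L H, of "a n"] zero[of n] bergman_add[OF conjunct1[OF Suc] bergman_scale[OF H, of "a n"]]
    by simp
qed

text \<open>
  On the closed unit disk the Taylor polynomials of \<open>g\<close> converge uniformly, hence they converge
  in the Bergman norm.
\<close>
lemma functional_zero_beyond_disk:
  assumes L: "bounded_functional L" and zero: "\<And>k. L (on_disk (\<lambda>z. z ^ k)) = 0"
    and g: "g holomorphic_on ball 0 R" and R: "R > 1"
  shows "L (on_disk g) = 0"
proof -
  define a where "a n = (deriv ^^ n) g 0 / fact n" for n
  have sums: "(\<lambda>n. a n * z ^ n) sums g z" if "z \<in> ball 0 R" for z
    using holomorphic_power_series[OF g that] by (simp add: a_def)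
  obtain \<rho> where \<rho>: "1 < \<rho>" "\<rho> < R" using R dense by blast
  have "summable (\<lambda>n. a n * of_real \<rho> ^ n)"
    using sums[of "of_real \<rho>"] \<rho> by (auto simp: sums_iff)
  then have "conv_radius a \<ge> norm (complex_of_real \<rho>)"
    by (rule conv_radius_geI)
  then have "ereal 1 < conv_radius a"
    using \<rho> by (smt (verit) less_ereal.simps(1) norm_of_real order_less_le_trans)
  then have "uniform_limit (cball 0 1) (\<lambda>n x. \<Sum>i<n. a i * (x - 0) ^ i) (\<lambda>x. suminf (\<lambda>i. a i * (x - 0) ^ i)) sequentially"
    by (rule powser_uniform_limit)
  then have unif: "uniform_limit (ball 0 1) (\<lambda>n z. \<Sum>i<n. a i * z ^ i) (\<lambda>z. \<Sum>i. a i * z ^ i) sequentially"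
    using uniform_limit_on_subset ball_subset_cball by fastforce
  have suminf: "(\<Sum>i. a i * z ^ i) = g z" if "z \<in> ball 0 1" for z
    using sums[of z] that R by (auto simp: sums_iff)
  have g1: "g holomorphic_on ball 0 1"
    using g R by (auto intro: holomorphic_on_subset)
  have "bounded (g ` cball 0 1)"
    using R by (intro compact_imp_bounded compact_continuous_image
        holomorphic_on_imp_continuous_on[OF holomorphic_on_subset[OF g]]) auto
  then obtain B where "\<And>z. z \<in> cball 0 1 \<Longrightarrow> cmod (g z) \<le> B"
    unfolding bounded_iff by blast
  then have gH: "on_disk g \<in> bergman_space"
    by (intro bergman_bounded(1)[OF g1, of B]) auto
  show ?thesis
  proof (rule functional_zero_limit[OF L gH, of "\<lambda>n. on_disk (\<lambda>z. \<Sum>i<n. a i * z ^ i)"])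
    show "on_disk (\<lambda>z. \<Sum>i<n. a i * z ^ i) \<in> bergman_space" for n
      using functional_polynomials_zero[OF L zero] by blast
    show "L (on_disk (\<lambda>z. \<Sum>i<n. a i * z ^ i)) = 0" for n
      using functional_polynomials_zero[OF L zero] by blast
    show "(\<lambda>n. sqnorm (\<lambda>z. on_disk (\<lambda>z. \<Sum>i<n. a i * z ^ i) z - on_disk g z)) \<longlonglongrightarrow> 0"
    proof (rule LIMSEQ_I)
      fix \<epsilon> :: real assume \<epsilon>: "\<epsilon> > 0"
      define \<eta> where "\<eta> = sqrt (\<epsilon> / (2 * pi))"
      have \<eta>: "\<eta> > 0" "\<eta>\<^sup>2 * pi = \<epsilon> / 2" using \<epsilon> by (auto simp: \<eta>_def)
      obtain N where "\<forall>n\<ge>N. \<forall>z\<in>ball 0 1. dist (\<Sum>i<n. a i * z ^ i) (\<Sum>i. a i * z ^ i) < \<eta>"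
        using uniform_limitD[OF unif \<eta>(1)] unfolding eventually_sequentially by blast
      then have N: "cmod ((\<Sum>i<n. a i * z ^ i) - g z) < \<eta>" if "n \<ge> N" "z \<in> ball 0 1" for n z
        using that suminf[OF that(2)] by (metis dist_norm)
      have "norm (sqnorm (\<lambda>z. on_disk (\<lambda>z. \<Sum>i<n. a i * z ^ i) z - on_disk g z) - 0) < \<epsilon>" if "n \<ge> N" for n
      proof -
        have "(\<lambda>z. on_disk (\<lambda>z. \<Sum>i<n. a i * z ^ i) z - on_disk g z) = on_disk (\<lambda>z. (\<Sum>i<n. a i * z ^ i) - g z)"
          by (auto simp: fun_eq_iff on_disk_def)
        moreover have "sqnorm (on_disk (\<lambda>z. (\<Sum>i<n. a i * z ^ i) - g z)) \<le> \<eta>\<^sup>2 * pi"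
          using N[OF that] by (intro bergman_bounded(2)) (auto intro!: holomorphic_intros g1 less_imp_le)
        ultimately show ?thesis using \<eta>(2) \<epsilon> by simp
      qed
      then show "\<exists>no. \<forall>n\<ge>no. norm (sqnorm (\<lambda>z. on_disk (\<lambda>z. \<Sum>i<n. a i * z ^ i) z - on_disk g z) - 0) < \<epsilon>"
        by blast
    qed
  qed
qed

definition dilate :: "real \<Rightarrow> (complex \<Rightarrow> complex) \<Rightarrow> complex \<Rightarrow> complex" where
  "dilate \<rho> f = on_disk (\<lambda>z. f (of_real \<rho> * z))"

lemma dilate_bergman:
  assumes f: "f \<in> bergman_space" and \<rho>: "0 < \<rho>" "\<rho> \<le> 1"
  shows "dilate \<rho> f \<in> bergman_space" and "sqnorm (dilate \<rho> f) \<le> sqnorm f / \<rho>\<^sup>2"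
proof -
  have sub: "of_real \<rho> * z \<in> ball (0::complex) 1" if "z \<in> ball 0 1" for z
    using that \<rho> mult_le_cancel_right1[of \<rho> "cmod z"] by (auto simp: norm_mult intro: le_less_trans[OF mult_left_le_one_le])
  have hol: "(\<lambda>z. f (of_real \<rho> * z)) holomorphic_on ball 0 1"
    by (rule holomorphic_on_compose_gen[OF _ bergman_holomorphic[OF f], unfolded o_def])
       (use sub in \<open>auto intro!: holomorphic_intros\<close>)
  note aff = integral_affine[OF bergman_integrable[OF f] \<rho>(1), of 0]
  have bd: "(cmod (dilate \<rho> f z))\<^sup>2 \<le> (cmod (f (0 + of_real \<rho> * z)))\<^sup>2" for z
    by (simp add: dilate_def on_disk_def)
  note * = bergman_dominated[OF on_disk_holomorphic[OF hol] on_disk_outside aff(1)]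
  show "dilate \<rho> f \<in> bergman_space"
    unfolding dilate_def by (rule *(1)) (use bd in \<open>auto simp: dilate_def\<close>)
  have "sqnorm (dilate \<rho> f) \<le> (\<integral>z. (cmod (f (0 + of_real \<rho> * z)))\<^sup>2 \<partial>lborel)"
    unfolding dilate_def by (rule *(2)) (use bd in \<open>auto simp: dilate_def\<close>)
  also have "\<dots> = sqnorm f / \<rho>\<^sup>2"
    using aff(2) \<rho> by (simp add: sqnorm_def field_simps)
  finally show "sqnorm (dilate \<rho> f) \<le> sqnorm f / \<rho>\<^sup>2" .
qed

text \<open>
  Dilations converge pointwise, and the norms do not exceed the norm of \<open>f\<close> in the limit; together
  this forces convergence in norm. Dominated convergence is applied after truncating by a
  multiple of \<open>G\<close>, which avoids constructing a common majorant for the dilations. With \<open>G\<close>,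
  \<open>Gn\<close> and \<open>D\<close> the squared moduli of \<open>f\<close>, of its dilation and of their difference, \<open>D \<le> 2 Gn + 2 G\<close> gives
  \<open>D \<le> min D (4 G) + 2 (Gn - G) + 2 max 0 (G - Gn)\<close>. The first and last terms are dominated by
  multiples of \<open>G\<close>, and the integral of the middle one is controlled by the bound on the norm of
  a dilation.
\<close>
lemma dilate_tendsto:
  assumes f: "f \<in> bergman_space" and \<rho>: "\<And>n. 0 < \<rho> n" "\<And>n. \<rho> n \<le> 1" and lim: "\<rho> \<longlonglongrightarrow> 1"
  shows "(\<lambda>n. sqnorm (\<lambda>z. dilate (\<rho> n) f z - f z)) \<longlonglongrightarrow> 0"
proof -
  define G where "G z = (cmod (f z))\<^sup>2" for z
  define Gn where "Gn n z = (cmod (dilate (\<rho> n) f z))\<^sup>2" for n z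
  define D where "D n z = (cmod (dilate (\<rho> n) f z - f z))\<^sup>2" for n z
  note H = dilate_bergman[OF f \<rho>]
  have [measurable]: "f \<in> borel_measurable borel" "dilate (\<rho> n) f \<in> borel_measurable borel" for n
    using bergman_measurable f H(1) by auto
  have [measurable]: "G \<in> borel_measurable borel" "Gn n \<in> borel_measurable borel" "D n \<in> borel_measurable borel" for n
    unfolding G_def Gn_def D_def by measurable
  have intG: "integrable lborel G" and intGn: "integrable lborel (Gn n)" and intD: "integrable lborel (D n)" for n
    unfolding G_def Gn_def D_def
    using bergman_integrable[OF f] bergman_integrable[OF H(1)] bergman_integrable[OF bergman_diff[OF H(1) f]] by auto
  have pt: "(\<lambda>n. dilate (\<rho> n) f z) \<longlonglongrightarrow> f z" for z
  proof (cases "z \<in> ball 0 1")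
    case True
    have "isCont f z"
      using holomorphic_on_imp_continuous_on[OF bergman_holomorphic[OF f]] True
      by (simp add: continuous_on_eq_continuous_at)
    moreover have "(\<lambda>n. of_real (\<rho> n) * z) \<longlonglongrightarrow> of_real 1 * z"
      by (intro tendsto_intros lim)
    ultimately have "(\<lambda>n. f (of_real (\<rho> n) * z)) \<longlonglongrightarrow> f z"
      using isCont_tendsto_compose by fastforce
    then show ?thesis using True by (simp add: dilate_def)
  next
    case False
    then show ?thesis using bergman_outside[OF f False] by (simp add: dilate_def)
  qed
  have ptG: "(\<lambda>n. Gn n z) \<longlonglongrightarrow> G z" for z
    unfolding Gn_def G_def by (intro tendsto_intros pt)
  have ptD: "(\<lambda>n. D n z) \<longlonglongrightarrow> 0" for z
    unfolding D_def by (rule tendsto_eq_intros pt | simp)+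
  have lim1: "(\<lambda>n. \<integral>z. max 0 (G z - Gn n z) \<partial>lborel) \<longlonglongrightarrow> (\<integral>z. 0 \<partial>(lborel :: complex measure))"
  proof (rule integral_dominated_convergence[where w = G])
    have "(\<lambda>n. max 0 (G z - Gn n z)) \<longlonglongrightarrow> max 0 (G z - G z)" for z
      by (intro tendsto_intros ptG)
    then show "AE z in lborel. (\<lambda>n. max 0 (G z - Gn n z)) \<longlonglongrightarrow> 0"
      by simp
    show "AE z in lborel. norm (max 0 (G z - Gn n z)) \<le> G z" for n
      by (auto simp: G_def Gn_def)
  qed (use intG in auto)
  have lim2: "(\<lambda>n. \<integral>z. min (D n z) (4 * G z) \<partial>lborel) \<longlonglongrightarrow> (\<integral>z. 0 \<partial>(lborel :: complex measure))"
  proof (rule integral_dominated_convergence[where w = "\<lambda>z. 4 * G z"])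
    have "(\<lambda>n. min (D n z) (4 * G z)) \<longlonglongrightarrow> min 0 (4 * G z)" for z
      by (intro tendsto_intros ptD)
    then show "AE z in lborel. (\<lambda>n. min (D n z) (4 * G z)) \<longlonglongrightarrow> 0"
      by (simp add: G_def)
    show "AE z in lborel. norm (min (D n z) (4 * G z)) \<le> 4 * G z" for n
      by (auto simp: D_def G_def)
  qed (use intG in auto)
  have upper: "sqnorm (\<lambda>z. dilate (\<rho> n) f z - f z) \<le>
      (\<integral>z. min (D n z) (4 * G z) \<partial>lborel) + 2 * (sqnorm f / (\<rho> n)\<^sup>2 - sqnorm f)
        + 2 * (\<integral>z. max 0 (G z - Gn n z) \<partial>lborel)" for n
  proof -
    have i1: "integrable lborel (\<lambda>z. min (D n z) (4 * G z))"
      using intD intG by (intro integrable_min) auto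
    have i2: "integrable lborel (\<lambda>z. max 0 (G z - Gn n z))"
      using intGn intG by (intro integrable_max) auto
    have le: "D n z \<le> min (D n z) (4 * G z) + 2 * (Gn n z - G z) + 2 * max 0 (G z - Gn n z)" for z
    proof -
      have "D n z \<le> 2 * Gn n z + 2 * G z"
        using cmod_add_sq_le[of "dilate (\<rho> n) f z" "- f z"] by (simp add: D_def Gn_def G_def)
      then show ?thesis by (auto simp: min_def max_def)
    qed
    have "sqnorm (\<lambda>z. dilate (\<rho> n) f z - f z) = (\<integral>z. D n z \<partial>lborel)"
      by (simp add: sqnorm_def D_def)
    also have "\<dots> \<le> (\<integral>z. min (D n z) (4 * G z) + 2 * (Gn n z - G z) + 2 * max 0 (G z - Gn n z) \<partial>lborel)"
      using i1 i2 intD intG intGn le by (intro integral_mono) auto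
    also have "\<dots> = (\<integral>z. min (D n z) (4 * G z) \<partial>lborel) + 2 * ((\<integral>z. Gn n z \<partial>lborel) - (\<integral>z. G z \<partial>lborel))
        + 2 * (\<integral>z. max 0 (G z - Gn n z) \<partial>lborel)"
      using i1 i2 intG intGn by simp
    also have "(\<integral>z. G z \<partial>lborel) = sqnorm f"
      by (simp add: sqnorm_def G_def)
    also have "(\<integral>z. Gn n z \<partial>lborel) = sqnorm (dilate (\<rho> n) f)"
      by (simp add: sqnorm_def Gn_def)
    also have "(\<integral>z. min (D n z) (4 * G z) \<partial>lborel) + 2 * (sqnorm (dilate (\<rho> n) f) - sqnorm f)
          + 2 * (\<integral>z. max 0 (G z - Gn n z) \<partial>lborel)
        \<le> (\<integral>z. min (D n z) (4 * G z) \<partial>lborel) + 2 * (sqnorm f / (\<rho> n)\<^sup>2 - sqnorm f)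
          + 2 * (\<integral>z. max 0 (G z - Gn n z) \<partial>lborel)"
      by (intro add_mono mult_left_mono diff_mono H(2)) auto
    finally show ?thesis .
  qed
  have "(\<lambda>n. (\<integral>z. min (D n z) (4 * G z) \<partial>lborel) + 2 * (sqnorm f / (\<rho> n)\<^sup>2 - sqnorm f)
        + 2 * (\<integral>z. max 0 (G z - Gn n z) \<partial>lborel)) \<longlonglongrightarrow>
      (\<integral>z. 0 \<partial>(lborel :: complex measure)) + 2 * (sqnorm f / 1\<^sup>2 - sqnorm f) + 2 * (\<integral>z. 0 \<partial>(lborel :: complex measure))"
    by (intro tendsto_intros lim lim1 lim2) simp
  then have upper_lim: "(\<lambda>n. (\<integral>z. min (D n z) (4 * G z) \<partial>lborel) + 2 * (sqnorm f / (\<rho> n)\<^sup>2 - sqnorm f)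
        + 2 * (\<integral>z. max 0 (G z - Gn n z) \<partial>lborel)) \<longlonglongrightarrow> 0"
    by simp
  show ?thesis
    by (rule tendsto_sandwich[OF always_eventually[OF allI] always_eventually[OF allI]
          tendsto_const upper_lim]) (rule sqnorm_nonneg upper)+
qed

text \<open>
  Density of the span of these powers, in dual form. Analytic continuation in \<open>s\<close> reaches the nonnegative integers, hence all
  polynomials, hence all functions holomorphic beyond the disk, among them the dilations of \<open>f\<close>,
  which converge to \<open>f\<close>.
\<close>
theorem functional_zero_if_cpower_zero:
  assumes L: "bounded_functional L" and \<delta>: "\<delta> > 0"
    and zero: "\<And>s. -1 < Re s \<Longrightarrow> Re s < -1 + \<delta> \<Longrightarrow> L (cpower s) = 0"
    and f: "f \<in> bergman_space"
  shows "L f = 0"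
proof -
  have "L (cpower (of_nat m)) = 0" for m
    by (rule functional_cpower_zero[OF L \<delta> zero]) auto
  then have mono: "L (on_disk (\<lambda>z. z ^ k)) = 0" for k
    using functional_monomials_zero[OF L, of 0 k] by simp
  define \<rho> where "\<rho> n = 1 - 1 / (real n + 2)" for n
  have \<rho>: "0 < \<rho> n" "\<rho> n < 1" for n
    by (auto simp: \<rho>_def field_simps)
  have lim: "\<rho> \<longlonglongrightarrow> 1"
    unfolding \<rho>_def by real_asymp
  show ?thesis
  proof (rule functional_zero_limit[OF L f, of "\<lambda>n. dilate (\<rho> n) f"])
    show "dilate (\<rho> n) f \<in> bergman_space" for n
      using dilate_bergman(1)[OF f] \<rho>[of n] by simp
    show "L (dilate (\<rho> n) f) = 0" for n
      unfolding dilate_def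
    proof (rule functional_zero_beyond_disk[OF L mono])
      show "(\<lambda>z. f (of_real (\<rho> n) * z)) holomorphic_on ball 0 (1 / \<rho> n)"
        by (rule holomorphic_on_compose_gen[OF _ bergman_holomorphic[OF f], unfolded o_def])
           (use \<rho>[of n] in \<open>auto intro!: holomorphic_intros simp: norm_mult field_simps\<close>)
      show "1 < 1 / \<rho> n" using \<rho>[of n] by simp
    qed
    show "(\<lambda>n. sqnorm (\<lambda>z. dilate (\<rho> n) f z - f z)) \<longlonglongrightarrow> 0"
      using \<rho> by (intro dilate_tendsto f lim less_imp_le)
  qed
qed

section \<open>Extended eigenvalues of the composition operator\<close>

lemma affine_map_disk:
  assumes "0 < r" "r < 1" "z \<in> ball 0 1"
  shows "of_real r * z + 1 - of_real r \<in> ball (0::complex) 1"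
proof -
  have "cmod (of_real r * z + of_real (1 - r)) \<le> cmod (of_real r * z) + cmod (of_real (1 - r))"
    by (rule norm_triangle_ineq)
  also have "\<dots> = r * cmod z + (1 - r)"
    using assms by (simp only: norm_mult norm_of_real abs_of_pos abs_of_nonneg diff_ge_0_iff_ge less_imp_le)
  also have "\<dots> < r * 1 + (1 - r)"
    using assms by (intro add_strict_right_mono mult_strict_left_mono) auto
  finally show ?thesis by (simp add: add_diff_eq)
qed

context
  fixes r :: real and \<phi> :: "complex \<Rightarrow> complex"
  assumes r: "0 < r" "r < 1"
    and \<phi>: "\<And>z. z \<in> ball 0 1 \<Longrightarrow> \<phi> z = of_real r * z + 1 - of_real r"
begin

lemma phi_disk: "z \<in> ball 0 1 \<Longrightarrow> \<phi> z \<in> ball 0 1"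
  using affine_map_disk[OF r] \<phi> by simp

lemma one_minus_phi: "z \<in> ball 0 1 \<Longrightarrow> 1 - \<phi> z = of_real r * (1 - z)"
  using \<phi> by (simp add: algebra_simps)

text \<open>
  In the coordinate \<open>w = 1 - z\<close> the map \<open>\<phi>\<close> is multiplication by \<open>r\<close>. Since \<open>r\<close> is a positive
  real, the principal logarithm is additive here and the eigenvalue is $r^s$.
\<close>
lemma composition_cpower:
  "composition_operator \<phi> (cpower s) = (\<lambda>z. exp (s * of_real (ln r)) * cpower s z)"
proof
  fix z
  show "composition_operator \<phi> (cpower s) z = exp (s * of_real (ln r)) * cpower s z"
  proof (cases "z \<in> ball 0 1")
    case True
    have "Ln (1 - \<phi> z) = of_real (ln r) + Ln (1 - z)"
      unfolding one_minus_phi[OF True] using r disk_complement_pos(2)[OF True]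
      by (simp add: Ln_times_of_real Ln_of_real)
    then show ?thesis
      using True phi_disk[OF True]
      by (simp add: composition_operator_def cpower_def distrib_left exp_add del: mem_ball mem_ball_0)
  next
    case False
    then show ?thesis by (simp add: composition_operator_def cpower_def del: mem_ball mem_ball_0)
  qed
qed

lemma phi_image_eq: "\<phi> ` ball 0 1 = ball (of_real (1 - r)) r"
proof (intro set_eqI iffI)
  fix w assume "w \<in> \<phi> ` ball 0 1"
  then obtain z where z: "z \<in> ball 0 1" "w = \<phi> z" by blast
  have "of_real (1 - r) - \<phi> z = - (of_real r * z)"
    using \<phi>[OF z(1)] by (simp add: algebra_simps)
  then have "cmod (of_real (1 - r) - \<phi> z) = r * cmod z"
    using r by (simp only: norm_minus_cancel norm_mult norm_of_real abs_of_pos)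
  then show "w \<in> ball (of_real (1 - r)) r"
    using z r by (simp add: dist_norm)
next
  fix w assume w: "w \<in> ball (complex_of_real (1 - r)) r"
  define z where "z = (w - of_real (1 - r)) / of_real r"
  have "cmod z = cmod (w - of_real (1 - r)) / r"
    unfolding z_def norm_divide using r by simp
  also have "\<dots> < 1"
    using w r by (simp add: dist_norm norm_minus_commute)
  finally have "z \<in> ball 0 1" by simp
  moreover have "of_real r * z + 1 - of_real r = w"
    using r by (simp add: z_def field_simps)
  ultimately show "w \<in> \<phi> ` ball 0 1"
    using \<phi>[of z] by (metis imageI)
qed

lemma composition_injective:
  assumes f: "f \<in> bergman_space" and 0: "composition_operator \<phi> f = (\<lambda>z. 0)"
  shows "f = (\<lambda>z. 0)"
proof (rule bergman_eq_0_if_AE_0_on_open[OF f, of "\<phi> ` ball 0 1"])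
  have "f (\<phi> z) = 0" if "z \<in> ball 0 1" for z
    using fun_cong[OF 0, of z] that by (simp add: composition_operator_def)
  then show "AE w in lborel. w \<in> \<phi> ` ball 0 1 \<longrightarrow> f w = 0" by auto
  show "open (\<phi> ` ball 0 1)" unfolding phi_image_eq by simp
qed (use phi_disk in auto)

text \<open>
  Composition with \<open>\<phi>\<close> divides the integral over the image disk \<open>\<phi> ` ball 0 1\<close> by \<open>r\<^sup>2\<close>. For an
  eigenvector with \<open>cmod \<mu> \<ge> 1 / r\<close> the image disk therefore carries at least the whole squared
  norm of \<open>f\<close>, so \<open>f\<close> vanishes almost everywhere on the rest of the unit disk, which contains a
  nonempty open set. The borderline case of equality is excluded too.
\<close>
lemma composition_eigenvalue_bound:
  assumes f: "f \<in> bergman_space" and eig: "composition_operator \<phi> f = (\<lambda>z. \<mu> * f z)"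
    and \<mu>: "cmod \<mu> \<ge> 1 / r"
  shows "f = (\<lambda>z. 0)"
proof -
  define E where "E = \<phi> ` ball 0 1"
  have E: "E = ball (of_real (1 - r)) r" by (simp add: E_def phi_image_eq)
  define F where "F = (\<lambda>z. indicat_real E z * (cmod (f z))\<^sup>2)"
  have intf: "integrable lborel (\<lambda>z. (cmod (f z))\<^sup>2)"
    by (rule bergman_integrable[OF f])
  have intF: "integrable lborel F"
    unfolding F_def using integrable_real_mult_indicator[OF _ intf, of E]
    by (simp add: E mult.commute)
  have Feq: "F (of_real (1 - r) + of_real r * z) = (cmod \<mu>)\<^sup>2 * (cmod (f z))\<^sup>2" for z
  proof (cases "z \<in> ball 0 1")
    case True
    have \<phi>z: "of_real (1 - r) + of_real r * z = \<phi> z"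
      using \<phi>[OF True] by simp
    have "f (\<phi> z) = \<mu> * f z"
      using fun_cong[OF eig, of z] True by (simp add: composition_operator_def)
    moreover have "\<phi> z \<in> E" using True by (simp add: E_def)
    ultimately show ?thesis
      unfolding \<phi>z by (simp add: F_def norm_mult power_mult_distrib)
  next
    case False
    have "cmod (of_real r * z) \<ge> r"
      using False r by (simp add: norm_mult)
    then have "of_real (1 - r) + of_real r * z \<notin> E"
      by (simp add: E dist_norm)
    then show ?thesis using bergman_outside[OF f False] by (simp add: F_def)
  qed
  have "r\<^sup>2 * ((cmod \<mu>)\<^sup>2 * sqnorm f) = (\<integral>z. F z \<partial>lborel)"
    using integral_affine(2)[OF intF r(1), of "of_real (1 - r)"] unfolding Feq by (simp add: sqnorm_def)
  moreover have "1 \<le> (r * cmod \<mu>)\<^sup>2"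
    using \<mu> r by (intro one_le_power) (simp add: field_simps)
  then have "sqnorm f \<le> r\<^sup>2 * ((cmod \<mu>)\<^sup>2 * sqnorm f)"
    using mult_right_mono[of 1 "(r * cmod \<mu>)\<^sup>2" "sqnorm f"] by (simp add: power_mult_distrib mult.assoc)
  ultimately have "(\<integral>z. (cmod (f z))\<^sup>2 - F z \<partial>lborel) \<le> 0"
    using intf intF by (simp add: sqnorm_def)
  moreover have nonneg: "0 \<le> (cmod (f z))\<^sup>2 - F z" for z
    by (simp add: F_def indicator_def)
  ultimately have "(\<integral>z. (cmod (f z))\<^sup>2 - F z \<partial>lborel) = 0"
    using integral_nonneg_AE[of "\<lambda>z. (cmod (f z))\<^sup>2 - F z" lborel] by (simp add: order_antisym)
  then have AE: "AE z in lborel. (cmod (f z))\<^sup>2 - F z = 0"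
    using nonneg intf intF by (subst (asm) integral_nonneg_eq_0_iff_AE) auto
  \<comment> \<open>The closed image disk is removed to make \<open>U\<close> open.\<close>
  define U where "U = ball 0 1 - cball (complex_of_real (1 - r)) r"
  show ?thesis
  proof (rule bergman_eq_0_if_AE_0_on_open[OF f])
    show "AE z in lborel. z \<in> U \<longrightarrow> f z = 0"
      using AE by eventually_elim (auto simp: U_def F_def E indicator_def split: if_splits)
    show "open U" unfolding U_def by (intro open_Diff) auto
    show "U \<subseteq> ball 0 1" by (auto simp: U_def)
    have "cmod (of_real (1 - r) - of_real (- r)) = 1"
      unfolding of_real_diff[symmetric] by simp
    then have "complex_of_real (- r) \<in> U"
      using r by (auto simp: U_def dist_norm)
    then show "U \<noteq> {}" by blast
  qed
qed

text \<open>
  The intertwining operator is multiplication by $(1-z)^s$ where $r^s = \<mu>$. The condition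
  \<open>cmod \<mu> \<le> 1\<close> amounts to \<open>Re s \<ge> 0\<close>, which makes the multiplier bounded on the disk.
\<close>
lemma punctured_disk_subset_extended_eigenvalues:
  assumes "0 < cmod \<mu>" "cmod \<mu> \<le> 1"
  shows "\<mu> \<in> extended_eigenvalues bergman_space bergman_norm (composition_operator \<phi>)"
proof -
  define s where "s = Ln \<mu> / of_real (ln r)"
  have lnr: "ln r < 0" using r by simp
  have "Re s = ln (cmod \<mu>) / ln r"
    using assms by (simp add: s_def)
  moreover have "ln (cmod \<mu>) \<le> 0" using assms by simp
  ultimately have s: "Re s \<ge> 0" using lnr by (simp add: divide_nonpos_neg)
  have exps: "exp (s * of_real (ln r)) = \<mu>"
    using lnr assms by (simp add: s_def)
  define X where "X f = on_disk (\<lambda>z. cpower s z * f z)" for f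
  define B where "B = exp (\<bar>Im s\<bar> * pi) * 2 powr Re s"
  have hol: "cpower s holomorphic_on ball 0 1"
    by (rule bergman_holomorphic[OF cpower_in_bergman]) (use s in simp)
  have B: "cmod (cpower s z) \<le> B" if z: "z \<in> ball 0 1" for z
  proof -
    have "cmod (exp (s * Ln (1 - z))) \<le> exp (\<bar>Im s\<bar> * pi) * cmod (1 - z) powr Re s"
      by (rule norm_exp_mult_Ln_le[OF disk_complement_pos(2)[OF z]])
    also have "\<dots> \<le> B"
      unfolding B_def using disk_complement_pos(4)[OF z] s by (intro mult_left_mono powr_mono2) auto
    finally show ?thesis using z by (simp add: cpower_def)
  qed
  have "B \<ge> 0" by (simp add: B_def)
  have bop: "bounded_operator_on bergman_space bergman_norm X"
    unfolding bounded_operator_on_def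
  proof (intro conjI ballI allI exI)
    fix f assume f: "f \<in> bergman_space"
    note * = bergman_bounded_mult[OF f hol B]
    show Xf: "X f \<in> bergman_space" unfolding X_def by (rule *(1))
    have "sqnorm (X f) / pi \<le> B\<^sup>2 * (sqnorm f / pi)"
      using *(2) by (simp add: X_def divide_right_mono)
    then have "sqrt (sqnorm (X f) / pi) \<le> sqrt (B\<^sup>2 * (sqnorm f / pi))"
      by simp
    then show "bergman_norm (X f) \<le> B * bergman_norm f"
      unfolding bergman_norm_eq[OF f] bergman_norm_eq[OF Xf] using \<open>B \<ge> 0\<close>
      by (simp only: real_sqrt_mult real_sqrt_abs abs_of_nonneg)
  qed (auto simp: X_def on_disk_def fun_eq_iff algebra_simps)
  define one where "one = on_disk (\<lambda>z. 1)"
  have one: "one \<in> bergman_space"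
    unfolding one_def by (rule bergman_bounded(1)[where B = 1]) auto
  have "X one 0 \<noteq> 0"
    by (simp add: X_def one_def cpower_def)
  then have "X one \<noteq> (\<lambda>z. 0)" by auto
  moreover have "composition_operator \<phi> (X f) = (\<lambda>z. \<mu> * X (composition_operator \<phi> f) z)" for f
  proof
    fix z
    show "composition_operator \<phi> (X f) z = \<mu> * X (composition_operator \<phi> f) z"
    proof (cases "z \<in> ball 0 1")
      case True
      have "cpower s (\<phi> z) = \<mu> * cpower s z"
        using fun_cong[OF composition_cpower[of s], of z] True by (simp add: composition_operator_def exps)
      then show ?thesis
        using True phi_disk[OF True] by (simp add: composition_operator_def X_def del: mem_ball mem_ball_0)
    qed (simp add: composition_operator_def X_def del: mem_ball mem_ball_0)
  qed
  ultimately show ?thesis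
    unfolding extended_eigenvalues_def using bop one by blast
qed

text \<open>
  An intertwining \<open>X\<close> sends the eigenvector $(1-z)^s$ to an eigenvector for $\<mu> r^s$, or to 0. If
  \<open>cmod \<mu> > 1\<close>, then for \<open>Re s\<close> close to $-1$ the number $\<mu> r^s$ has modulus at least $1/r$ and
  is no eigenvalue, so \<open>X\<close> kills a total family of vectors.
\<close>
lemma extended_eigenvalue_bounds:
  assumes "\<mu> \<in> extended_eigenvalues bergman_space bergman_norm (composition_operator \<phi>)"
  shows "0 < cmod \<mu>" and "cmod \<mu> \<le> 1"
proof -
  obtain X f0 where X: "bounded_operator_on bergman_space bergman_norm X"
    and f0: "f0 \<in> bergman_space" "X f0 \<noteq> (\<lambda>z. 0)"
    and comm: "\<And>f. f \<in> bergman_space \<Longrightarrow> composition_operator \<phi> (X f) = (\<lambda>z. \<mu> * X (composition_operator \<phi> f) z)"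
    using assms unfolding extended_eigenvalues_def by blast
  have XH: "X f \<in> bergman_space" if "f \<in> bergman_space" for f
    using X that by (simp add: bounded_operator_on_def)
  have X_add: "X (\<lambda>z. f z + g z) = (\<lambda>z. X f z + X g z)" if "f \<in> bergman_space" "g \<in> bergman_space" for f g
    using X that by (simp add: bounded_operator_on_def)
  have X_scale: "X (\<lambda>z. c * f z) = (\<lambda>z. c * X f z)" if "f \<in> bergman_space" for c f
    using X that by (simp add: bounded_operator_on_def)
  obtain K where K: "\<And>f. f \<in> bergman_space \<Longrightarrow> bergman_norm (X f) \<le> K * bergman_norm f"
    using X unfolding bounded_operator_on_def by blast
  show "0 < cmod \<mu>"
  proof (rule ccontr)
    assume "\<not> 0 < cmod \<mu>"
    then have "composition_operator \<phi> (X f0) = (\<lambda>z. 0)"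
      using comm[OF f0(1)] by simp
    then show False
      using composition_injective[OF XH[OF f0(1)]] f0(2) by blast
  qed
  show "cmod \<mu> \<le> 1"
  proof (rule ccontr)
    assume "\<not> cmod \<mu> \<le> 1"
    then have \<mu>: "cmod \<mu> > 1" by simp
    then have "\<mu> \<noteq> 0" by auto
    have lnr: "ln r < 0" using r by simp
    \<comment> \<open>The strip where \<open>cmod \<mu> * r powr Re s \<ge> 1 / r\<close> is \<open>Re s \<le> -1 + \<delta>\<close>.\<close>
    define \<delta> where "\<delta> = ln (cmod \<mu>) / (- ln r)"
    have \<delta>: "\<delta> > 0" unfolding \<delta>_def using ln_gt_zero[OF \<mu>] lnr by (intro divide_pos_pos) auto
    have X_cpower: "X (cpower s) = (\<lambda>z. 0)" if s: "-1 < Re s" "Re s < -1 + \<delta>" for s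
    proof (rule composition_eigenvalue_bound)
      note cH = cpower_in_bergman[OF s(1)]
      show "X (cpower s) \<in> bergman_space" by (rule XH[OF cH])
      show "composition_operator \<phi> (X (cpower s)) = (\<lambda>z. (\<mu> * exp (s * of_real (ln r))) * X (cpower s) z)"
        unfolding comm[OF cH] composition_cpower X_scale[OF cH] by (simp add: mult.assoc)
      have "(Re s + 1) * (- ln r) \<le> \<delta> * (- ln r)"
        using s lnr by (intro mult_right_mono) auto
      also have "\<delta> * (- ln r) = ln (cmod \<mu>)"
        using lnr by (simp add: \<delta>_def)
      finally have "- ln r \<le> ln (cmod \<mu>) + Re s * ln r"
        by (simp add: algebra_simps)
      then have "exp (- ln r) \<le> exp (ln (cmod \<mu>) + Re s * ln r)"
        by simp
      moreover have "exp (- ln r) = 1 / r"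
        using r by (simp add: exp_minus field_simps)
      moreover have "exp (ln (cmod \<mu>) + Re s * ln r) = cmod (\<mu> * exp (s * of_real (ln r)))"
        using \<mu> \<open>\<mu> \<noteq> 0\<close> by (simp add: exp_add norm_mult)
      ultimately show "1 / r \<le> cmod (\<mu> * exp (s * of_real (ln r)))" by simp
    qed
    \<comment> \<open>Pairing with \<open>X f0\<close> itself turns \<open>L f0 = 0\<close> into \<open>X f0 = 0\<close>.\<close>
    define L where "L f = inner_L2 (X f) (X f0)" for f
    have "bounded_functional L"
      unfolding bounded_functional_def
    proof (intro conjI ballI allI exI)
      fix f assume f: "f \<in> bergman_space"
      fix g assume g: "g \<in> bergman_space"
      show "L (\<lambda>z. f z + g z) = L f + L g"
        using inner_L2_integrable[OF XH[OF f] XH[OF f0(1)]] inner_L2_integrable[OF XH[OF g] XH[OF f0(1)]]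
        by (simp add: L_def X_add f g inner_L2_def distrib_right)
    next
      fix c f assume f: "f \<in> bergman_space"
      show "L (\<lambda>z. c * f z) = c * L f"
        by (simp add: L_def X_scale f inner_L2_def mult.assoc)
    next
      fix f assume f: "f \<in> bergman_space"
      have "sqrt (sqnorm (X f)) \<le> K * sqrt (sqnorm f)"
        using K[OF f] by (simp add: bergman_norm_eq XH f real_sqrt_divide divide_le_cancel)
      then have "sqrt (sqnorm (X f)) * sqrt (sqnorm (X f0)) \<le> K * sqrt (sqnorm f) * sqrt (sqnorm (X f0))"
        by (intro mult_right_mono) auto
      then show "cmod (L f) \<le> (K * sqrt (sqnorm (X f0))) * sqrt (sqnorm f)"
        using inner_L2_le[OF XH[OF f] XH[OF f0(1)]] by (simp add: L_def mult.assoc mult.commute mult.left_commute)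
    qed
    moreover have "L (cpower s) = 0" if "-1 < Re s" "Re s < -1 + \<delta>" for s
      using X_cpower[OF that] by (simp add: L_def inner_L2_def)
    ultimately have "L f0 = 0"
      using functional_zero_if_cpower_zero[OF _ \<delta> _ f0(1)] by blast
    then have "sqnorm (X f0) = 0"
      by (simp add: L_def inner_L2_self)
    then have "AE z in lborel. X f0 z = 0"
      unfolding sqnorm_def using bergman_integrable[OF XH[OF f0(1)]]
      by (subst (asm) integral_nonneg_eq_0_iff_AE) auto
    then have "X f0 = (\<lambda>z. 0)"
      by (intro bergman_eq_0_if_AE_0_on_open[OF XH[OF f0(1)], of "ball 0 1"]) auto
    then show False using f0(2) by blast
  qed
qed

end

theorem theorem4p13:
  fixes r :: real and \<phi> :: "complex \<Rightarrow> complex"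
  assumes "0 < r" and "r < 1"
    and "\<And>z. z \<in> ball 0 1 \<Longrightarrow> \<phi> z = of_real r * z + 1 - of_real r"
  shows "extended_eigenvalues bergman_space bergman_norm (composition_operator \<phi>) = cball 0 1 - {0} \<and>
         cball 0 1 - {0} = {\<mu>::complex. 0 < cmod \<mu> \<and> cmod \<mu> \<le> 1}"
proof
  show disk: "cball 0 1 - {0} = {\<mu>::complex. 0 < cmod \<mu> \<and> cmod \<mu> \<le> 1}"
    by auto
  show "extended_eigenvalues bergman_space bergman_norm (composition_operator \<phi>) = cball 0 1 - {0}"
    unfolding disk
    using extended_eigenvalue_bounds[OF assms] punctured_disk_subset_extended_eigenvalues[OF assms] by blast
qed

end
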